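(* Let $\lambda$ be a regular uncountable cardinal for which the weak diamond holds, i.e. $\lambda\notin\mathrm{WDmId}_\lambda$. Let $\mathfrak K$ be a class of models which is closed under isomorphisms and categorical in $\lambda$ (all members of $\mathfrak K_\lambda$ are isomorphic), let $\le_{\mathfrak K}$ be a $\lambda$-nice partial order on $\mathfrak K_\lambda$, and let $M\in\mathfrak K_\lambda$. Let $\langle A_\alpha:\alpha<\lambda\rangle$ be an increasing continuous sequence of subsets of $|M|$ such that $|A_\alpha|<\lambda$ for all $\alpha<\lambda$ and $\bigcup_{\alpha<\lambda}A_\alpha=|M|$. Then the set $$S=\{\alpha<\lambda:\ \text{the pair }(A_\alpha,M)\text{ does not have the amalgamation property in }\mathfrak K_\lambda\}$$ belongs to $\mathrm{WDmId}_\lambda$.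
   Context: $\mathcal H(\lambda)$: sets hereditarily of cardinality $<\lambda$. A $\lambda$-colouring is a function $F:\mathrm{DOM}\to2$ where $\mathrm{DOM}$ is ${}^{<\lambda}2$ or $\bigcup_{\alpha<\lambda}{}^\alpha(\mathcal H(\lambda))$; $\mathrm{DOM}_\lambda$ is ${}^\lambda2$, resp. ${}^\lambda(\mathcal H(\lambda))$. For $S\subseteq\lambda$, $\eta\in{}^S2$ is an $F$-weak diamond sequence for $S$ if for every $f\in\mathrm{DOM}_\lambda$ the set $\{\delta\in S:\eta(\delta)=F(f\restriction\delta)\}$ is stationary. $\mathrm{WDmId}_\lambda$ is the family of all $S\subseteq\lambda$ such that for some $\lambda$-colouring $F$ there is no $F$-weak diamond sequence for $S$. $|N|$ denotes the universe of a model $N$. $\mathfrak K_\lambda$ is the class of members of $\mathfrak K$ of cardinality $\lambda$. A partial order $\le_{\mathfrak K}$ on $\mathfrak K_\lambda$ is $\lambda$-nice if ($\alpha$) it refines the submodel relation $\subseteq$ and is preserved by isomorphisms (if $M\le_{\mathfrak K}N$ and $f:N\to N'\in\mathfrak K_\lambda$ is an isomorphism then $f[M]\le_{\mathfrak K}N'$); ($\beta$) every $\le_{\mathfrak K}$-increasing sequence of length $\le\lambda$ of members of $\mathfrak K_\lambda$ has a $\le_{\mathfrak K}$-upper bound in $\mathfrak K_\lambda$; ($\gamma$) for every $\le_{\mathfrak K}$-increasing $\langle M_\alpha:\alpha<\lambda\rangle$ in $\mathfrak K_\lambda$, $\bigcup_{\alpha<\lambda}M_\alpha\in\mathfrak K_\lambda$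 and it is a $\le_{\mathfrak K}$-upper bound of the sequence. A $\le_{\mathfrak K}$-embedding of $N_1$ into $N^*$ is an isomorphism of $N_1$ onto some $N'\le_{\mathfrak K}N^*$. For $N\in\mathfrak K_\lambda$ and $A\subseteq|N|$, the pair $(A,N)$ has the amalgamation property in $\mathfrak K_\lambda$ if for all $N_1,N_2\in\mathfrak K_\lambda$ with $N\le_{\mathfrak K}N_1$, $N\le_{\mathfrak K}N_2$ there are $N^*\in\mathfrak K_\lambda$ and $\le_{\mathfrak K}$-embeddings $f_1,f_2$ of $N_1,N_2$ into $N^*$ with $f_1\restriction A=f_2\restriction A$. *)

theory Defs
  imports Main
begin

unbundle cardinal_syntax

text \<open>
  The cardinal \<open>\<lambda>\<close> is a well-ordered type \<open>'k\<close>: the elements of \<open>'k\<close> are the ordinals below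
  \<open>\<lambda>\<close>, an ordinal \<open>\<alpha> < \<lambda>\<close> is identified with the initial segment \<open>{..<\<alpha>}\<close>, and \<open>\<lambda>\<close> itself
  with \<open>UNIV\<close>.  That the order type of \<open>'k\<close> is an initial ordinal is part of the next definition.
\<close>

definition regular_uncountable_cardinal :: "'k::wellorder itself \<Rightarrow> bool" where
  "regular_uncountable_cardinal _ \<longleftrightarrow>
     (let lam = {(\<alpha>, \<beta>::'k). \<alpha> \<le> \<beta>}
      in card_order lam \<and> regularCard lam \<and> natLeq <o lam)"

definition limit_ordinal :: "'k::wellorder \<Rightarrow> bool" where
  "limit_ordinal \<delta> \<longleftrightarrow> {..<\<delta>} \<noteq> {} \<and> (\<forall>\<alpha><\<delta>. \<exists>\<beta><\<delta>. \<alpha> < \<beta>)"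

definition club :: "'k::wellorder set \<Rightarrow> bool" where
  "club C \<longleftrightarrow> (\<forall>\<alpha>. \<exists>\<beta>\<in>C. \<alpha> < \<beta>) \<and>
     (\<forall>\<delta>. limit_ordinal \<delta> \<longrightarrow> (\<forall>\<alpha><\<delta>. \<exists>\<beta>\<in>C. \<alpha> < \<beta> \<and> \<beta> < \<delta>) \<longrightarrow> \<delta> \<in> C)"

definition stationary :: "'k::wellorder set \<Rightarrow> bool" where
  "stationary S \<longleftrightarrow> (\<forall>C. club C \<longrightarrow> S \<inter> C \<noteq> {})"

text \<open>
  Well-founded sets are coded by well-founded trees: \<open>Node g\<close> codes the set whose elements are
  the sets coded by the members of \<open>ran g\<close>.  Two codes denote the same set iff they are
  extensionally equal, hereditarily, so a set is an equivalence class of codes.  A set is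
  hereditarily of cardinality \<open>< |'k|\<close> iff it has a code all of whose index sets \<open>dom g\<close> have
  cardinality \<open>< |'k|\<close>.  The lemmas \<open>H_lam_extensionality\<close>, \<open>H_lam_comprehension\<close>,
  \<open>H_lam_members_small\<close> and \<open>H_lam_induct\<close> below determine \<open>(H_lam, H_mem)\<close> up to isomorphism.
\<close>

datatype 'k set_code = Node "'k \<Rightarrow> 'k set_code option"

inductive same_set :: "'k set_code \<Rightarrow> 'k set_code \<Rightarrow> bool" where
  "\<forall>u\<in>ran g. \<exists>v\<in>ran h. same_set u v \<Longrightarrow> \<forall>v\<in>ran h. \<exists>u\<in>ran g. same_set u v \<Longrightarrow>
     same_set (Node g) (Node h)"

inductive hereditarily_small :: "'k set_code \<Rightarrow> bool" where
  "|dom g| <o |UNIV :: 'k set| \<Longrightarrow> \<forall>u\<in>ran g. hereditarily_small u \<Longrightarrow>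
     hereditarily_small (Node (g :: 'k \<rightharpoonup> 'k set_code))"

definition same_set_rel :: "'k set_code rel" where
  "same_set_rel = {(u, v). hereditarily_small u \<and> hereditarily_small v \<and> same_set u v}"

definition H_lam :: "'k set_code set set" where
  "H_lam = {u. hereditarily_small u} // same_set_rel"

definition H_mem :: "'k set_code set \<Rightarrow> 'k set_code set \<Rightarrow> bool" where
  "H_mem x y \<longleftrightarrow> (\<exists>g. Node g \<in> y \<and> ran g \<inter> x \<noteq> {})"

text \<open>
  A sequence of length \<open>\<alpha>\<close> is a partial function with domain \<open>{..<\<alpha>}\<close>, so that the length can be
  recovered from it; \<open>f \<restriction> \<delta>\<close> is \<open>f |` {..<\<delta>}\<close>.  A colouring of the sequences
  of length \<open>< \<lambda>\<close> of elements of \<open>X\<close> is a predicate on partial functions; its values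
  at partial functions that are not such sequences are never used, since
  only the restrictions of members of \<open>DOM_lam X\<close> to initial segments matter.  The set \<open>2\<close> is \<open>bool\<close>.
\<close>

definition DOM_lam :: "'x set \<Rightarrow> ('k::wellorder \<rightharpoonup> 'x) set" where
  "DOM_lam X = {f. dom f = UNIV \<and> ran f \<subseteq> X}"

definition weak_diamond_sequence ::
  "'x set \<Rightarrow> (('k::wellorder \<rightharpoonup> 'x) \<Rightarrow> bool) \<Rightarrow> 'k set \<Rightarrow> ('k \<Rightarrow> bool) \<Rightarrow> bool" where
  "weak_diamond_sequence X F S \<eta> \<longleftrightarrow>
     (\<forall>f\<in>DOM_lam X. stationary {\<delta>\<in>S. \<eta> \<delta> = F (f |` {..<\<delta>})})"

text \<open>Both kinds of colourings are admitted: on sequences from \<open>2\<close> and on sequences from \<open>H_lam\<close>.\<close>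

definition WDmId :: "'k::wellorder set set" where
  "WDmId =
     {S. (\<exists>F :: ('k \<rightharpoonup> bool) \<Rightarrow> bool. \<nexists>\<eta>. weak_diamond_sequence UNIV F S \<eta>) \<or>
         (\<exists>F :: ('k \<rightharpoonup> 'k set_code set) \<Rightarrow> bool. \<nexists>\<eta>. weak_diamond_sequence H_lam F S \<eta>)}"

text \<open>
  A vocabulary assigns arities to its symbols (\<open>None\<close>: not a symbol of the vocabulary).  Functions
  are given by their graphs.  Interpretations live on the universe only and symbols outside the
  vocabulary are interpreted by the empty set, so that equality of models is equality of records.
  Universes are subsets of a type \<open>'u\<close>, which plays the role of the set-theoretic universe: a class
  of models is a set of models over an arbitrary such \<open>'u\<close>.  No bound on the size of \<open>'u\<close> is
  imposed; taking it larger than \<open>\<lambda>\<close> leaves room to extend every model of cardinality \<open>\<lambda>\<close>.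
\<close>

record ('f, 'p) vocabulary =
  fun_arity :: "'f \<Rightarrow> nat option"
  rel_arity :: "'p \<Rightarrow> nat option"

record ('u, 'f, 'p) model =
  universe :: "'u set"
  funs :: "'f \<Rightarrow> ('u list \<times> 'u) set"
  rels :: "'p \<Rightarrow> 'u list set"

definition tuples :: "nat option \<Rightarrow> 'u set \<Rightarrow> 'u list set" where
  "tuples n U = {xs. n = Some (length xs) \<and> set xs \<subseteq> U}"

definition is_model :: "('f, 'p) vocabulary \<Rightarrow> ('u, 'f, 'p) model \<Rightarrow> bool" where
  "is_model \<tau> N \<longleftrightarrow>
     (\<forall>F. funs N F \<subseteq> tuples (fun_arity \<tau> F) (universe N) \<times> universe N \<and>
          (\<forall>xs \<in> tuples (fun_arity \<tau> F) (universe N). \<exists>!y. (xs, y) \<in> funs N F)) \<and>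
     (\<forall>P. rels N P \<subseteq> tuples (rel_arity \<tau> P) (universe N))"

definition submodel :: "('u, 'f, 'p) model \<Rightarrow> ('u, 'f, 'p) model \<Rightarrow> bool" where
  "submodel M N \<longleftrightarrow> universe M \<subseteq> universe N \<and>
     (\<forall>F. funs M F = {(xs, y) \<in> funs N F. set xs \<subseteq> universe M}) \<and>
     (\<forall>P. rels M P = {xs \<in> rels N P. set xs \<subseteq> universe M})"

definition isomorphism ::
  "('u \<Rightarrow> 'u) \<Rightarrow> ('u, 'f, 'p) model \<Rightarrow> ('u, 'f, 'p) model \<Rightarrow> bool" where
  "isomorphism f M N \<longleftrightarrow> bij_betw f (universe M) (universe N) \<and>
     (\<forall>F xs y. set xs \<subseteq> universe M \<longrightarrow> y \<in> universe M \<longrightarrow>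
        ((xs, y) \<in> funs M F \<longleftrightarrow> (map f xs, f y) \<in> funs N F)) \<and>
     (\<forall>P xs. set xs \<subseteq> universe M \<longrightarrow> (xs \<in> rels M P \<longleftrightarrow> map f xs \<in> rels N P))"

definition image_model :: "('u \<Rightarrow> 'u) \<Rightarrow> ('u, 'f, 'p) model \<Rightarrow> ('u, 'f, 'p) model" where
  "image_model f M =
     \<lparr>universe = f ` universe M,
      funs = (\<lambda>F. (\<lambda>(xs, y). (map f xs, f y)) ` funs M F),
      rels = (\<lambda>P. map f ` rels M P)\<rparr>"

definition Union_model :: "('k \<Rightarrow> ('u, 'f, 'p) model) \<Rightarrow> ('u, 'f, 'p) model" where
  "Union_model Ms =
     \<lparr>universe = (\<Union>\<alpha>. universe (Ms \<alpha>)),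
      funs = (\<lambda>F. \<Union>\<alpha>. funs (Ms \<alpha>) F),
      rels = (\<lambda>P. \<Union>\<alpha>. rels (Ms \<alpha>) P)\<rparr>"

definition closed_under_isomorphisms ::
  "('f, 'p) vocabulary \<Rightarrow> ('u, 'f, 'p) model set \<Rightarrow> bool" where
  "closed_under_isomorphisms \<tau> K \<longleftrightarrow>
     (\<forall>M\<in>K. \<forall>N f. is_model \<tau> N \<longrightarrow> isomorphism f M N \<longrightarrow> N \<in> K)"

definition members_of_card ::
  "'k itself \<Rightarrow> ('u, 'f, 'p) model set \<Rightarrow> ('u, 'f, 'p) model set" where
  "members_of_card _ K = {N\<in>K. |universe N| =o |UNIV :: 'k set|}"

definition categorical :: "'k itself \<Rightarrow> ('u, 'f, 'p) model set \<Rightarrow> bool" where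
  "categorical lam K \<longleftrightarrow>
     (\<forall>M \<in> members_of_card lam K. \<forall>N \<in> members_of_card lam K. \<exists>f. isomorphism f M N)"

definition increasing_sequence ::
  "('u, 'f, 'p) model set \<Rightarrow> ('u, 'f, 'p) model rel \<Rightarrow> 'k::wellorder set \<Rightarrow>
   ('k \<Rightarrow> ('u, 'f, 'p) model) \<Rightarrow> bool" where
  "increasing_sequence Kl leK I Ms \<longleftrightarrow>
     (\<forall>\<alpha>\<in>I. Ms \<alpha> \<in> Kl) \<and> (\<forall>\<alpha>\<in>I. \<forall>\<beta>\<in>I. \<alpha> \<le> \<beta> \<longrightarrow> (Ms \<alpha>, Ms \<beta>) \<in> leK)"

text \<open>Below, \<open>I\<close> ranges over the lengths \<open>\<le> \<lambda>\<close>, i.e. the initial segments of \<open>'k\<close>.\<close>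

definition nice_order ::
  "'k::wellorder itself \<Rightarrow> ('u, 'f, 'p) model set \<Rightarrow> ('u, 'f, 'p) model rel \<Rightarrow> bool" where
  "nice_order lam K leK \<longleftrightarrow>
     (let Kl = members_of_card lam K in
      partial_order_on Kl leK \<and>
      (\<forall>(M, N) \<in> leK. submodel M N \<and>
         (\<forall>N'\<in>Kl. \<forall>f. isomorphism f N N' \<longrightarrow> (image_model f M, N') \<in> leK)) \<and>
      (\<forall>(I :: 'k set) Ms. I = UNIV \<or> (\<exists>\<gamma>. I = {..<\<gamma>}) \<longrightarrow> increasing_sequence Kl leK I Ms \<longrightarrow>
         (\<exists>N\<in>Kl. \<forall>\<alpha>\<in>I. (Ms \<alpha>, N) \<in> leK)) \<and>
      (\<forall>Ms :: 'k \<Rightarrow> _. increasing_sequence Kl leK UNIV Ms \<longrightarrow>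
         Union_model Ms \<in> Kl \<and> (\<forall>\<alpha>. (Ms \<alpha>, Union_model Ms) \<in> leK)))"

definition K_embedding ::
  "('u, 'f, 'p) model rel \<Rightarrow> ('u \<Rightarrow> 'u) \<Rightarrow> ('u, 'f, 'p) model \<Rightarrow> ('u, 'f, 'p) model \<Rightarrow> bool" where
  "K_embedding leK f N1 N \<longleftrightarrow> (\<exists>N'. (N', N) \<in> leK \<and> isomorphism f N1 N')"

definition amalgamation_property ::
  "('u, 'f, 'p) model set \<Rightarrow> ('u, 'f, 'p) model rel \<Rightarrow> 'u set \<Rightarrow> ('u, 'f, 'p) model \<Rightarrow> bool" where
  "amalgamation_property Kl leK A N \<longleftrightarrow>
     (\<forall>N1\<in>Kl. \<forall>N2\<in>Kl. (N, N1) \<in> leK \<longrightarrow> (N, N2) \<in> leK \<longrightarrow>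
        (\<exists>N0\<in>Kl. \<exists>f1 f2. K_embedding leK f1 N1 N0 \<and> K_embedding leK f2 N2 N0 \<and>
           (\<forall>a\<in>A. f1 a = f2 a)))"

lemma same_set_Node:
  "same_set (Node g) (Node h) \<longleftrightarrow>
     (\<forall>u\<in>ran g. \<exists>v\<in>ran h. same_set u v) \<and> (\<forall>v\<in>ran h. \<exists>u\<in>ran g. same_set u v)"
  by (subst same_set.simps) blast

lemma hereditarily_small_Node:
  "hereditarily_small (Node (g :: 'k \<rightharpoonup> 'k set_code)) \<longleftrightarrow>
     |dom g| <o |UNIV :: 'k set| \<and> (\<forall>u\<in>ran g. hereditarily_small u)"
  by (subst hereditarily_small.simps) blast

lemma set_code_induct:
  assumes "\<And>g. (\<And>u. u \<in> ran g \<Longrightarrow> P u) \<Longrightarrow> P (Node g)"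
  shows "P u"
proof (induction u)
  case (Node g)
  show ?case
  proof (rule assms)
    fix u assume "u \<in> ran g"
    then obtain i where "g i = Some u" by (auto simp: ran_def)
    then show "P u" using Node[of "Some u" u] by (metis option.set_intros rangeI)
  qed
qed

lemma same_set_refl: "same_set u u"
  by (induction u rule: set_code_induct) (auto simp: same_set_Node)

lemma same_set_sym: "same_set u v \<Longrightarrow> same_set v u"
proof (induction rule: same_set.induct)
  case (1 g h)
  then show ?case unfolding same_set_Node by blast
qed

lemma same_set_trans: "same_set u v \<Longrightarrow> same_set v w \<Longrightarrow> same_set u w"
proof (induction arbitrary: w rule: same_set.induct)
  case (1 g h)
  obtain l where w: "w = Node l" by (cases w)
  have hl: "\<forall>v\<in>ran h. \<exists>x\<in>ran l. same_set v x" "\<forall>x\<in>ran l. \<exists>v\<in>ran h. same_set v x"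
    using 1 unfolding w same_set_Node by blast+
  show ?case unfolding w same_set_Node
  proof (intro conjI ballI)
    fix u assume "u \<in> ran g"
    then obtain v where v: "v \<in> ran h" "\<And>x. same_set v x \<Longrightarrow> same_set u x" using 1(1) by blast
    then show "\<exists>x\<in>ran l. same_set u x" using hl(1) by blast
  next
    fix x assume "x \<in> ran l"
    then obtain v where v: "v \<in> ran h" "same_set v x" using hl(2) by blast
    then show "\<exists>u\<in>ran g. same_set u x" using 1(2) by blast
  qed
qed

lemma equiv_same_set: "equiv {u. hereditarily_small u} same_set_rel"
  unfolding same_set_rel_def
  by (intro equivI) (auto simp: refl_on_def sym_def trans_def
      intro: same_set_refl same_set_sym same_set_trans)

lemma H_lam_obtain:
  assumes "x \<in> H_lam"
  obtains g where "x = same_set_rel `` {Node g}" "hereditarily_small (Node g)"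
  using assms unfolding H_lam_def by (metis quotientE mem_Collect_eq set_code.exhaust)

lemma H_lamI: "hereditarily_small u \<Longrightarrow> same_set_rel `` {u} \<in> H_lam"
  unfolding H_lam_def by (simp add: quotientI)

lemma class_eq_iff:
  assumes "hereditarily_small u" "hereditarily_small v"
  shows "same_set_rel `` {u} = same_set_rel `` {v} \<longleftrightarrow> same_set u v"
  using eq_equiv_class_iff[OF equiv_same_set] assms by (auto simp: same_set_rel_def)

lemma H_mem_class:
  assumes "x \<in> H_lam" "hereditarily_small (Node g)"
  shows "H_mem x (same_set_rel `` {Node g}) \<longleftrightarrow> (\<exists>v\<in>ran g. x = same_set_rel `` {v})"
proof -
  obtain u where u: "x = same_set_rel `` {u}" "hereditarily_small u"
    using assms(1) by (metis H_lam_obtain)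
  have mem: "v \<in> x \<longleftrightarrow> hereditarily_small v \<and> same_set u v" for v
    using u by (auto simp: same_set_rel_def)
  have small: "v \<in> ran g \<Longrightarrow> hereditarily_small v" for v
    using assms(2) by (simp add: hereditarily_small_Node)
  show ?thesis
  proof
    assume "H_mem x (same_set_rel `` {Node g})"
    then obtain h w where h: "same_set (Node g) (Node h)" "w \<in> ran h" "same_set u w"
      unfolding H_mem_def using mem by (auto simp: same_set_rel_def)
    then obtain v where v: "v \<in> ran g" "same_set v w" by (auto simp: same_set_Node)
    then have "same_set u v" using h(3) by (blast intro: same_set_sym same_set_trans)
    then show "\<exists>v\<in>ran g. x = same_set_rel `` {v}"
      using u v(1) small class_eq_iff by blast
  next
    assume "\<exists>v\<in>ran g. x = same_set_rel `` {v}"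
    then obtain v where v: "v \<in> ran g" "x = same_set_rel `` {v}" by blast
    then have "v \<in> x" using small by (auto simp: same_set_rel_def same_set_refl)
    moreover have "Node g \<in> same_set_rel `` {Node g}"
      using assms(2) same_set_refl by (auto simp: same_set_rel_def)
    ultimately show "H_mem x (same_set_rel `` {Node g})"
      unfolding H_mem_def using v(1) by blast
  qed
qed

lemma H_lam_extensionality:
  assumes "x \<in> H_lam" "y \<in> H_lam" "\<And>z. z \<in> H_lam \<Longrightarrow> H_mem z x \<longleftrightarrow> H_mem z y"
  shows "x = y"
proof -
  obtain g where x: "x = same_set_rel `` {Node g}" "hereditarily_small (Node g)"
    using assms(1) by (rule H_lam_obtain)
  obtain h where y: "y = same_set_rel `` {Node h}" "hereditarily_small (Node h)"
    using assms(2) by (rule H_lam_obtain)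
  have eq: "(\<exists>u\<in>ran g. z = same_set_rel `` {u}) \<longleftrightarrow> (\<exists>v\<in>ran h. z = same_set_rel `` {v})"
    if "z \<in> H_lam" for z
    using assms(3)[OF that] H_mem_class[OF that] x y by auto
  have g: "hereditarily_small u" if "u \<in> ran g" for u
    using x(2) that by (simp add: hereditarily_small_Node)
  have h: "hereditarily_small v" if "v \<in> ran h" for v
    using y(2) that by (simp add: hereditarily_small_Node)
  have "\<exists>v\<in>ran h. same_set u v" if "u \<in> ran g" for u
    using eq[OF H_lamI[OF g[OF that]]] that class_eq_iff g h by metis
  moreover have "\<exists>u\<in>ran g. same_set u v" if "v \<in> ran h" for v
    using eq[OF H_lamI[OF h[OF that]]] that class_eq_iff g h by metis
  ultimately show ?thesis using x y by (simp add: class_eq_iff same_set_Node)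
qed

lemma H_lam_comprehension:
  fixes X :: "'k set_code set set"
  assumes "X \<subseteq> H_lam" "|X| <o |UNIV :: 'k set|"
  shows "\<exists>y\<in>H_lam. \<forall>x\<in>H_lam. H_mem x y \<longleftrightarrow> x \<in> X"
proof -
  obtain e :: "'k set_code set \<Rightarrow> 'k" where e: "inj_on e X"
    using assms(2) card_of_ordLeq ordLess_imp_ordLeq by metis
  define rep where "rep x = (SOME u. hereditarily_small u \<and> x = same_set_rel `` {u})"
    for x :: "'k set_code set"
  have rep: "hereditarily_small (rep x) \<and> x = same_set_rel `` {rep x}" if "x \<in> X" for x
  proof -
    have "\<exists>u. hereditarily_small u \<and> x = same_set_rel `` {u}"
      using assms(1) that H_lam_obtain by blast
    then show ?thesis unfolding rep_def by (rule someI_ex)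
  qed
  define g where "g = (\<lambda>i. if i \<in> e ` X then Some (rep (inv_into X e i)) else None)"
  have dom: "dom g = e ` X" by (auto simp: g_def dom_def)
  have "ran g = (\<lambda>i. rep (inv_into X e i)) ` e ` X" by (auto simp: g_def ran_def)
  also have "\<dots> = rep ` X" using e by (simp add: image_image)
  finally have ran: "ran g = rep ` X" .
  have "|e ` X| <o |UNIV :: 'k set|"
    using card_of_image assms(2) ordLeq_ordLess_trans by blast
  then have small: "hereditarily_small (Node g)"
    using rep by (simp add: hereditarily_small_Node dom ran)
  show ?thesis
  proof (intro bexI ballI)
    fix x :: "'k set_code set" assume "x \<in> H_lam"
    then have "H_mem x (same_set_rel `` {Node g}) \<longleftrightarrow> (\<exists>a\<in>X. x = same_set_rel `` {rep a})"
      using H_mem_class[OF _ small] ran by auto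
    then show "H_mem x (same_set_rel `` {Node g}) \<longleftrightarrow> x \<in> X"
      using rep by metis
  qed (rule H_lamI[OF small])
qed

lemma H_lam_members_small:
  fixes y :: "'k set_code set"
  assumes "y \<in> H_lam"
  shows "|{x\<in>H_lam. H_mem x y}| <o |UNIV :: 'k set|"
proof -
  obtain g where y: "y = same_set_rel `` {Node g}" "hereditarily_small (Node g)"
    using assms by (rule H_lam_obtain)
  have "{x\<in>H_lam. H_mem x y} \<subseteq> (\<lambda>i. same_set_rel `` {the (g i)}) ` dom g"
  proof
    fix x assume "x \<in> {x\<in>H_lam. H_mem x y}"
    then obtain v where "v \<in> ran g" "x = same_set_rel `` {v}"
      using H_mem_class y by blast
    then show "x \<in> (\<lambda>i. same_set_rel `` {the (g i)}) ` dom g"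
      by (force simp: ran_def dom_def)
  qed
  then have "|{x\<in>H_lam. H_mem x y}| \<le>o |dom g|"
    by (rule ordLeq_transitive[OF card_of_mono1 card_of_image])
  moreover have "|dom g| <o |UNIV :: 'k set|"
    using y(2) by (simp add: hereditarily_small_Node)
  ultimately show ?thesis by (rule ordLeq_ordLess_trans)
qed

lemma H_lam_induct:
  assumes "x \<in> H_lam"
    and step: "\<And>y. y \<in> H_lam \<Longrightarrow> (\<And>z. z \<in> H_lam \<Longrightarrow> H_mem z y \<Longrightarrow> P z) \<Longrightarrow> P y"
  shows "P x"
proof -
  have "P (same_set_rel `` {u})" if "hereditarily_small u" for u
    using that
  proof (induction u rule: set_code_induct)
    case (1 g)
    show ?case
    proof (rule step[OF H_lamI[OF 1(2)]])
      fix z assume "z \<in> H_lam" "H_mem z (same_set_rel `` {Node g})"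
      then obtain v where "v \<in> ran g" "z = same_set_rel `` {v}"
        using H_mem_class 1(2) by blast
      then show "P z" using 1 by (auto simp: hereditarily_small_Node)
    qed
  qed
  then show ?thesis using assms(1) H_lam_obtain by metis
qed

end

theory Submission
  imports Defs
begin

text \<open>
  Suppose \<open>S\<close>, the set of \<open>\<alpha>\<close> where \<open>(A \<alpha>, M)\<close> fails to amalgamate, is not in the ideal.  Along every
  \<open>\<eta> \<in> \<^sup>\<lambda>2\<close> build an increasing chain \<open>N\<close>: at stage \<open>\<delta>\<close> take a pair \<open>P\<^sub>0, P\<^sub>1\<close> of upper bounds of the
  chain so far that cannot be amalgamated over the set \<open>B\<^sub>\<delta>\<close> of the first \<open>\<delta>\<close> elements of the
  first \<open>\<delta>\<close> models, if there is such a pair, and continue with the one selected by \<open>\<eta> \<delta>\<close>.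
  By categoricity there is an isomorphism \<open>h\<close> of the union \<open>U\<close> of the chain onto \<open>M\<close>, and
  \<open>h[B\<^sub>\<delta>] = A \<delta>\<close> for a club of \<open>\<delta>\<close>.  For such \<open>\<delta> \<in> S\<close> the pair \<open>P\<^sub>0, P\<^sub>1\<close> is not amalgamable: \<open>U\<close>
  bounds the chain below \<open>\<delta>\<close>, so copies of two extensions witnessing the failure for \<open>(A \<delta>, M)\<close>
  were available.

  The colouring asks, given \<open>\<eta> \<restriction> \<delta>\<close> and \<open>h \<restriction> B\<^sub>\<delta>\<close>, whether \<open>h \<restriction> B\<^sub>\<delta>\<close> extends to an embedding of
  \<open>P\<^sub>0\<close> into \<open>M\<close>.  Let \<open>\<eta>\<close> be a weak diamond sequence that guesses the answer correctly at \<open>\<delta>\<close>.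
  If \<open>\<eta> \<delta>\<close> holds, then \<open>P\<^sub>0\<close> embeds over \<open>h \<restriction> B\<^sub>\<delta>\<close>, and so does \<open>P\<^sub>1 = N \<delta>\<close>, via \<open>h\<close>, which
  amalgamates the pair; otherwise \<open>h\<close> itself embeds \<open>P\<^sub>0 = N \<delta>\<close>, contrary to the guess.
\<close>

subsection \<open>Regular cardinals and closure points\<close>

context
  assumes regular: "regular_uncountable_cardinal TYPE('k::wellorder)"
begin

lemma regular_cardD:
  shows "card_order {(\<alpha>, \<beta>::'k). \<alpha> \<le> \<beta>}" "regularCard {(\<alpha>, \<beta>::'k). \<alpha> \<le> \<beta>}"
    "{(\<alpha>, \<beta>::'k). \<alpha> \<le> \<beta>} =o |UNIV :: 'k set|" "natLeq <o |UNIV :: 'k set|"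
proof -
  let ?r = "{(\<alpha>, \<beta>::'k). \<alpha> \<le> \<beta>}"
  show c: "card_order ?r" and "regularCard ?r"
    using regular by (simp_all add: regular_uncountable_cardinal_def Let_def)
  show "?r =o |UNIV :: 'k set|" using c by (rule card_of_unique)
  then show "natLeq <o |UNIV :: 'k set|"
    using regular ordLess_ordIso_trans by (auto simp add: regular_uncountable_cardinal_def Let_def)
qed

lemma infinite_cardinal: "infinite (UNIV :: 'k set)"
  using regular_cardD(4) infinite_iff_natLeq_ordLeq ordLess_imp_ordLeq by blast

lemma ex_greater: "\<exists>\<beta>::'k. \<alpha> < \<beta>"
proof -
  let ?r = "{(\<alpha>, \<beta>::'k). \<alpha> \<le> \<beta>}"
  have F: "Field ?r = UNIV" by (auto simp: Field_def)
  have "\<exists>\<beta>\<in>UNIV. \<alpha> \<noteq> \<beta> \<and> (\<alpha>, \<beta>) \<in> ?r"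
    using infinite_Card_order_limit[of ?r \<alpha>] regular_cardD(1) infinite_cardinal unfolding F by simp
  then show ?thesis by (auto simp: less_le)
qed

text \<open>By regularity a cofinal set has cardinality \<lambda>, so a smaller set is bounded; the
  bound can be made strict because there is no last ordinal below \<lambda>.\<close>

lemma strict_upper_bound:
  assumes "|T| <o |UNIV :: 'k set|"
  shows "\<exists>\<beta>::'k. T \<subseteq> {..<\<beta>}"
proof -
  let ?r = "{(\<alpha>, \<beta>::'k). \<alpha> \<le> \<beta>}"
  have F: "Field ?r = UNIV" by (auto simp: Field_def)
  have "\<not> |T| =o ?r"
    using assms regular_cardD(3) not_ordLess_ordIso ordIso_transitive by blast
  then have "\<not> cofinal T ?r"
    using regular_cardD(2) unfolding regularCard_def F by blast
  then obtain \<alpha> where \<alpha>: "\<forall>b\<in>T. \<not> \<alpha> < b"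
    unfolding cofinal_def F by (auto simp: less_le)
  obtain \<beta> where "\<alpha> < \<beta>" using ex_greater by blast
  with \<alpha> have "T \<subseteq> {..<\<beta>}" by (force simp: not_less)
  then show ?thesis ..
qed

lemma initial_segment_small: "|{..\<alpha>::'k}| <o |UNIV :: 'k set|"
proof -
  let ?r = "{(\<alpha>, \<beta>::'k). \<alpha> \<le> \<beta>}"
  have F: "Field ?r = UNIV" by (auto simp: Field_def)
  obtain \<beta> where "\<alpha> < \<beta>" using ex_greater by blast
  then have "{..\<alpha>} \<subseteq> underS ?r \<beta>" by (auto simp: underS_def)
  moreover have "|underS ?r \<beta>| <o ?r"
    using card_of_underS[of ?r \<beta>] regular_cardD(1) F by auto
  ultimately show ?thesis
    by (meson card_of_mono1 ordLeq_ordLess_trans ordLess_ordIso_trans regular_cardD(3))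
qed

lemma small_image: "|T| <o |UNIV :: 'k set| \<Longrightarrow> |f ` T| <o |UNIV :: 'k set|"
  using card_of_image ordLeq_ordLess_trans by blast

lemma small_Un: "|T| <o |UNIV :: 'k set| \<Longrightarrow> |T'| <o |UNIV :: 'k set| \<Longrightarrow> |T \<union> T'| <o |UNIV :: 'k set|"
  using card_of_Un_ordLess_infinite[OF infinite_cardinal] by blast

lemma stable_UNIV: "stable |UNIV :: 'k set|"
proof -
  let ?r = "{(\<alpha>, \<beta>::'k). \<alpha> \<le> \<beta>}"
  have "Field ?r = UNIV" by (auto simp: Field_def)
  then have "stable ?r"
    using regularCard_stable[of ?r] regular_cardD(1,2) infinite_cardinal by simp
  then show ?thesis using regular_cardD(3) stable_ordIso1 ordIso_symmetric by blast
qed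

lemma small_Times:
  "|T| <o |UNIV :: 'k set| \<Longrightarrow> |T'| <o |UNIV :: 'k set| \<Longrightarrow> |T \<times> T'| <o |UNIV :: 'k set|"
  by (rule stable_elim[OF stable_UNIV])

text \<open>Unboundedness comes from closing off \<omega> times; closedness holds because
  \<open>T \<alpha>\<close> already lies below any closure point above \<alpha>.\<close>

lemma club_closure_points:
  fixes T :: "'k \<Rightarrow> 'k set"
  assumes "\<And>\<alpha>. |T \<alpha>| <o |UNIV :: 'k set|"
  shows "club {\<delta>. limit_ordinal \<delta> \<and> (\<forall>\<alpha><\<delta>. T \<alpha> \<subseteq> {..<\<delta>})}"
  unfolding club_def
proof (intro conjI allI impI)
  fix \<alpha>0 :: 'k
  obtain t where t: "\<And>\<alpha>. T \<alpha> \<subseteq> {..<t \<alpha>}"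
    using strict_upper_bound[OF assms] by metis
  have "\<exists>y. {..x} \<union> t ` {..x} \<subseteq> {..<y}" for x :: 'k
    by (intro strict_upper_bound small_Un small_image initial_segment_small)
  then obtain g where g: "\<And>x. {..x} \<union> t ` {..x} \<subseteq> {..<g x}" by metis
  define x where "x n = (g ^^ n) \<alpha>0" for n
  have step: "x n < x (Suc n)" "\<alpha> \<le> x n \<Longrightarrow> t \<alpha> < x (Suc n)" for n \<alpha>
    using g[of "x n"] unfolding x_def by auto
  \<comment> \<open>Uncountability enters here: the countable set of iterates is small, hence
    bounded. Its supremum is a limit since the iterates increase strictly.\<close>
  have "|range x| \<le>o natLeq"
    using card_of_image card_of_nat ordLeq_ordIso_trans by blast
  then have "|range x| <o |UNIV :: 'k set|"
    using regular_cardD(4) ordLeq_ordLess_trans by blast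
  then obtain y where y: "\<forall>n. x n < y" using strict_upper_bound by blast
  define \<delta> where "\<delta> = (LEAST y. \<forall>n. x n < y)"
  have \<delta>: "x n < \<delta>" for n unfolding \<delta>_def using LeastI_ex[of "\<lambda>y. \<forall>n. x n < y"] y by blast
  have below: "\<exists>n. \<alpha> \<le> x n" if "\<alpha> < \<delta>" for \<alpha>
    using not_less_Least[OF that[unfolded \<delta>_def]] by (auto simp: not_less)
  have "\<exists>\<beta><\<delta>. \<alpha> < \<beta>" if "\<alpha> < \<delta>" for \<alpha>
    using below[OF that] step(1) \<delta> by (metis le_less_trans)
  moreover have "T \<alpha> \<subseteq> {..<\<delta>}" if lt: "\<alpha> < \<delta>" for \<alpha>
  proof -
    obtain n where "\<alpha> \<le> x n" using below[OF lt] by blast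
    then have "t \<alpha> < \<delta>" using step(2) \<delta> less_trans by blast
    then show ?thesis using t[of \<alpha>] by force
  qed
  moreover have "\<alpha>0 < \<delta>" using \<delta>[of 0] by (simp add: x_def)
  ultimately show "\<exists>\<beta>\<in>{\<delta>. limit_ordinal \<delta> \<and> (\<forall>\<alpha><\<delta>. T \<alpha> \<subseteq> {..<\<delta>})}. \<alpha>0 < \<beta>"
    unfolding limit_ordinal_def by blast
next
  fix \<delta> :: 'k
  assume "limit_ordinal \<delta>"
    and unb: "\<forall>\<alpha><\<delta>. \<exists>\<beta>\<in>{\<delta>. limit_ordinal \<delta> \<and> (\<forall>\<alpha><\<delta>. T \<alpha> \<subseteq> {..<\<delta>})}. \<alpha> < \<beta> \<and> \<beta> < \<delta>"
  have "T \<alpha> \<subseteq> {..<\<delta>}" if "\<alpha> < \<delta>" for \<alpha>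
    using unb that by force
  with \<open>limit_ordinal \<delta>\<close> show "\<delta> \<in> {\<delta>. limit_ordinal \<delta> \<and> (\<forall>\<alpha><\<delta>. T \<alpha> \<subseteq> {..<\<delta>})}" by blast
qed

lemma ex_inj_Times: "\<exists>c :: 'k \<times> 'k \<Rightarrow> 'k. inj c"
  using card_of_Times_same_infinite[OF infinite_cardinal] card_of_ordLeq[of "UNIV::('k\<times>'k) set" "UNIV::'k set"]
  by (metis UNIV_Times_UNIV ordIso_imp_ordLeq)

lemma ex_inj_code: "\<exists>c :: 'k + 'k \<times> 'k \<times> 'k \<Rightarrow> 'k. inj c"
proof -
  obtain p :: "'k \<times> 'k \<Rightarrow> 'k" where p: "inj p" using ex_inj_Times by blast
  obtain \<alpha> \<beta> :: 'k where ne: "\<alpha> \<noteq> \<beta>" using ex_greater by (metis less_irrefl)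
  \<comment> \<open>The distinct first coordinates \<alpha> and \<beta> are tags separating the two
    summands.\<close>
  define c where "c x = (case x of Inl a \<Rightarrow> p (\<alpha>, a) | Inr (a, b, d) \<Rightarrow> p (\<beta>, p (a, p (b, d))))" for x
  have "inj c"
  proof (rule injI)
    fix x y assume "c x = c y"
    then show "x = y"
      by (cases x; cases y) (auto simp: c_def inj_eq[OF p] ne ne[symmetric])
  qed
  then show ?thesis by blast
qed

end

subsection \<open>Isomorphic copies of models\<close>

lemma isomorphism_comp:
  assumes "isomorphism f L M" "isomorphism g M N"
  shows "isomorphism (g \<circ> f) L N"
proof -
  have b: "bij_betw f (universe L) (universe M)" using assms(1) by (simp add: isomorphism_def)
  then have m: "set xs \<subseteq> universe L \<Longrightarrow> set (map f xs) \<subseteq> universe M" for xs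
    by (auto simp: bij_betw_def)
  have e: "y \<in> universe L \<Longrightarrow> f y \<in> universe M" for y using b by (auto simp: bij_betw_def)
  show ?thesis unfolding isomorphism_def
  proof (intro conjI allI impI)
    show "bij_betw (g \<circ> f) (universe L) (universe N)"
      using assms by (auto simp: isomorphism_def intro: bij_betw_trans)
  next
    fix F xs y assume a: "set xs \<subseteq> universe L" "y \<in> universe L"
    then have "(xs, y) \<in> funs L F \<longleftrightarrow> (map f xs, f y) \<in> funs M F"
      using assms(1) unfolding isomorphism_def by blast
    also have "\<dots> \<longleftrightarrow> (map g (map f xs), g (f y)) \<in> funs N F"
      using assms(2) m[OF a(1)] e[OF a(2)] unfolding isomorphism_def by blast
    finally show "(xs, y) \<in> funs L F \<longleftrightarrow> (map (g \<circ> f) xs, (g \<circ> f) y) \<in> funs N F" by simp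
  next
    fix P xs assume a: "set xs \<subseteq> universe L"
    then have "xs \<in> rels L P \<longleftrightarrow> map f xs \<in> rels M P"
      using assms(1) unfolding isomorphism_def by blast
    also have "\<dots> \<longleftrightarrow> map g (map f xs) \<in> rels N P"
      using assms(2) m[OF a(1)] unfolding isomorphism_def by blast
    finally show "xs \<in> rels L P \<longleftrightarrow> map (g \<circ> f) xs \<in> rels N P" by simp
  qed
qed

lemma is_model_funsD: "is_model \<tau> N \<Longrightarrow> (xs, y) \<in> funs N F \<Longrightarrow> set xs \<subseteq> universe N \<and> y \<in> universe N"
  unfolding is_model_def tuples_def by blast

lemma is_model_relsD: "is_model \<tau> N \<Longrightarrow> xs \<in> rels N P \<Longrightarrow> set xs \<subseteq> universe N"
  unfolding is_model_def tuples_def by blast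

lemma isomorphism_image_model:
  assumes "is_model \<tau> N" "inj_on f (universe N)"
  shows "isomorphism f N (image_model f N)"
proof -
  have inj: "map f xs = map f xs' \<Longrightarrow> xs = xs'"
    if "set xs \<subseteq> universe N" "set xs' \<subseteq> universe N" for xs xs'
    using that assms(2) by (meson inj_on_map_eq_map inj_on_subset le_sup_iff)
  show ?thesis unfolding isomorphism_def
  proof (intro conjI allI impI)
    show "bij_betw f (universe N) (universe (image_model f N))"
      using assms(2) by (simp add: image_model_def bij_betw_def)
  next
    fix F xs y assume a: "set xs \<subseteq> universe N" "y \<in> universe N"
    show "(xs, y) \<in> funs N F \<longleftrightarrow> (map f xs, f y) \<in> funs (image_model f N) F"
    proof
      assume "(map f xs, f y) \<in> funs (image_model f N) F"
      then obtain xs' y' where "(xs', y') \<in> funs N F" "map f xs = map f xs'" "f y = f y'"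
        by (auto simp: image_model_def)
      then show "(xs, y) \<in> funs N F"
        using is_model_funsD[OF assms(1)] a inj assms(2) by (metis inj_onD)
    qed (force simp: image_model_def)
  next
    fix P xs assume a: "set xs \<subseteq> universe N"
    show "xs \<in> rels N P \<longleftrightarrow> map f xs \<in> rels (image_model f N) P"
    proof
      assume "map f xs \<in> rels (image_model f N) P"
      then obtain xs' where "xs' \<in> rels N P" "map f xs = map f xs'"
        by (auto simp: image_model_def)
      then show "xs \<in> rels N P"
        using is_model_relsD[OF assms(1)] a inj by metis
    qed (auto simp: image_model_def)
  qed
qed

lemma is_model_image_model:
  assumes "is_model \<tau> N" "inj_on f (universe N)"
  shows "is_model \<tau> (image_model f N)"
proof -
  let ?U = "universe N"
  have tup: "tuples n (f ` ?U) = map f ` tuples n ?U" for n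
  proof
    show "tuples n (f ` ?U) \<subseteq> map f ` tuples n ?U"
    proof
      fix ys assume ys: "ys \<in> tuples n (f ` ?U)"
      then have "ys \<in> lists (f ` ?U)" by (auto simp: tuples_def)
      then obtain xs where "xs \<in> lists ?U" "ys = map f xs" by (auto simp: lists_image)
      then show "ys \<in> map f ` tuples n ?U" using ys by (auto simp: tuples_def)
    qed
  qed (auto simp: tuples_def intro!: imageI)
  have iso: "isomorphism f N (image_model f N)" by (rule isomorphism_image_model[OF assms])
  show ?thesis unfolding is_model_def
  proof (intro allI conjI ballI)
    fix F
    show "funs (image_model f N) F \<subseteq>
        tuples (fun_arity \<tau> F) (universe (image_model f N)) \<times> universe (image_model f N)"
    proof -
      have "funs N F \<subseteq> tuples (fun_arity \<tau> F) ?U \<times> ?U" using assms(1) by (simp add: is_model_def)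
      then show ?thesis by (auto simp: image_model_def tup)
    qed
    fix ys assume "ys \<in> tuples (fun_arity \<tau> F) (universe (image_model f N))"
    then obtain xs where xs: "ys = map f xs" "xs \<in> tuples (fun_arity \<tau> F) ?U"
      by (auto simp: image_model_def tup)
    then have xsU: "set xs \<subseteq> ?U" by (auto simp: tuples_def)
    obtain y where y: "(xs, y) \<in> funs N F" "\<And>y'. (xs, y') \<in> funs N F \<Longrightarrow> y' = y"
      using assms(1) xs(2) unfolding is_model_def by blast
    show "\<exists>!y. (ys, y) \<in> funs (image_model f N) F"
    proof
      show "(ys, f y) \<in> funs (image_model f N) F"
        using y(1) xs(1) by (force simp: image_model_def)
    next
      fix z assume z: "(ys, z) \<in> funs (image_model f N) F"
      then obtain xs' y' where "(xs', y') \<in> funs N F" "z = f y'" by (auto simp: image_model_def)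
      then have "y' \<in> ?U" "z = f y'" using is_model_funsD[OF assms(1)] by auto
      then have "(xs, y') \<in> funs N F" using iso xsU z xs(1) unfolding isomorphism_def by blast
      then show "z = f y" using y(2) \<open>z = f y'\<close> by blast
    qed
  next
    fix P
    have "rels N P \<subseteq> tuples (rel_arity \<tau> P) ?U" using assms(1) by (simp add: is_model_def)
    then show "rels (image_model f N) P \<subseteq> tuples (rel_arity \<tau> P) (universe (image_model f N))"
      by (auto simp: image_model_def tup)
  qed
qed

text \<open>An equality of records, because all graphs consist of tuples from the universe. It
  recovers a model that was moved and then relabelled back.\<close>

lemma image_model_inverse:
  assumes N: "is_model \<tau> N" and id: "\<And>x. x \<in> universe N \<Longrightarrow> g (f x) = x"
  shows "image_model g (image_model f N) = N"
proof -
  have l: "map (g \<circ> f) xs = xs" if "set xs \<subseteq> universe N" for xs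
    using id that by (auto intro!: map_idI)
  have "(g \<circ> f) ` universe N = universe N" using id by force
  moreover have "(\<lambda>(xs, y). (map (g \<circ> f) xs, (g \<circ> f) y)) ` funs N F = funs N F" for F
  proof -
    have "(case p of (xs, y) \<Rightarrow> (map (g \<circ> f) xs, (g \<circ> f) y)) = p" if "p \<in> funs N F" for p
      using that is_model_funsD[OF N, of "fst p" "snd p" F] l id by (cases p) auto
    then show ?thesis by force
  qed
  moreover have "map (g \<circ> f) ` rels N P = rels N P" for P
  proof -
    have "map (g \<circ> f) xs = xs" if "xs \<in> rels N P" for xs
      using is_model_relsD[OF N that] l by blast
    then show ?thesis by force
  qed
  ultimately show ?thesis
    by (cases N) (simp add: image_model_def image_image image_comp comp_def case_prod_unfold)
qed


subsection \<open>Branches of non-amalgamable pairs\<close>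

text \<open>Cutting the history off at \<delta> makes every recursive call descend, for an arbitrary
  functional \<open>P\<close>. The model at \<delta> depends on \<open>\<eta> \<delta>\<close> too,
  which picks the member of the pair.\<close>

function branch ::
  "('k::wellorder \<Rightarrow> ('k \<Rightarrow> 'm) \<Rightarrow> 'm \<times> 'm) \<Rightarrow> ('k \<Rightarrow> bool) \<Rightarrow> 'k \<Rightarrow> 'm" where
  "branch P \<eta> \<delta> =
     (if \<eta> \<delta> then snd else fst) (P \<delta> (\<lambda>\<alpha>. if \<alpha> < \<delta> then branch P \<eta> \<alpha> else undefined))"
  by pat_completeness auto
termination
  by (relation "inv_image {(x, y). x < y} (\<lambda>(P, \<eta>, \<delta>). \<delta>)") (auto intro: wf)

declare branch.simps [simp del]

lemma branch_cong:
  "(\<And>\<beta>. \<beta> \<le> \<alpha> \<Longrightarrow> \<eta> \<beta> = \<eta>' \<beta>) \<Longrightarrow> branch P \<eta> \<alpha> = branch P \<eta>' \<alpha>"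
proof (induction \<alpha> rule: less_induct)
  case (less \<alpha>)
  then have "(\<lambda>\<beta>. if \<beta> < \<alpha> then branch P \<eta> \<beta> else undefined) =
      (\<lambda>\<beta>. if \<beta> < \<alpha> then branch P \<eta>' \<beta> else undefined)"
    by (auto simp: fun_eq_iff)
  with less.prems[of \<alpha>] show ?case by (simp add: branch.simps[of P _ \<alpha>])
qed

section \<open>The order of a nice class, images of its models and embeddings\<close>

locale nice_class =
  fixes lam :: "'k::wellorder itself"
    and \<tau> :: "('f, 'p) vocabulary"
    and K :: "('u, 'f, 'p) model set"
    and leK :: "('u, 'f, 'p) model rel"
  assumes models: "\<forall>N\<in>K. is_model \<tau> N"
    and closed: "closed_under_isomorphisms \<tau> K"
    and nice: "nice_order lam K leK"
begin

abbreviation Kl :: "('u, 'f, 'p) model set" where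
  "Kl \<equiv> members_of_card lam K"

lemma is_model_Kl: "N \<in> Kl \<Longrightarrow> is_model \<tau> N"
  using models by (simp add: members_of_card_def)

lemma leK_partial_order: "partial_order_on Kl leK"
  using nice unfolding nice_order_def Let_def by (elim conjE)

lemma leK_Kl: "(M, N) \<in> leK \<Longrightarrow> M \<in> Kl \<and> N \<in> Kl"
  using leK_partial_order unfolding partial_order_on_def preorder_on_def by blast

lemma leK_refl: "N \<in> Kl \<Longrightarrow> (N, N) \<in> leK"
  using leK_partial_order unfolding partial_order_on_def preorder_on_def refl_on_def by blast

lemma leK_trans: "(L, M) \<in> leK \<Longrightarrow> (M, N) \<in> leK \<Longrightarrow> (L, N) \<in> leK"
  using leK_partial_order unfolding partial_order_on_def preorder_on_def by (blast dest: transD)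

lemma leK_nice:
  assumes "(M, N) \<in> leK"
  shows "submodel M N"
    and "isomorphism f N N' \<Longrightarrow> N' \<in> Kl \<Longrightarrow> (image_model f M, N') \<in> leK"
proof -
  have "\<forall>(M, N)\<in>leK. submodel M N \<and>
      (\<forall>N'\<in>Kl. \<forall>f. isomorphism f N N' \<longrightarrow> (image_model f M, N') \<in> leK)"
    using nice unfolding nice_order_def Let_def by (elim conjE)
  from bspec[OF this assms] show "submodel M N"
    and "isomorphism f N N' \<Longrightarrow> N' \<in> Kl \<Longrightarrow> (image_model f M, N') \<in> leK"
    by simp_all
qed

lemma leK_universe: "(M, N) \<in> leK \<Longrightarrow> universe M \<subseteq> universe N"
  using leK_nice(1) by (simp add: submodel_def)

lemmas leK_image = leK_nice(2)

lemma initial_chain_bound: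
  fixes Ms :: "'k \<Rightarrow> ('u, 'f, 'p) model"
  assumes "increasing_sequence Kl leK {..<\<delta>} Ms"
  shows "\<exists>N\<in>Kl. \<forall>\<alpha><\<delta>. (Ms \<alpha>, N) \<in> leK"
proof -
  have "\<forall>(I :: 'k set) Ms. I = UNIV \<or> (\<exists>\<gamma>. I = {..<\<gamma>}) \<longrightarrow> increasing_sequence Kl leK I Ms \<longrightarrow>
      (\<exists>N\<in>Kl. \<forall>\<alpha>\<in>I. (Ms \<alpha>, N) \<in> leK)"
    using nice unfolding nice_order_def Let_def by (elim conjE)
  from this[rule_format, OF _ assms] show ?thesis by auto
qed

lemma Union_chain:
  fixes Ms :: "'k \<Rightarrow> ('u, 'f, 'p) model"
  assumes "increasing_sequence Kl leK UNIV Ms"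
  shows "Union_model Ms \<in> Kl" "(Ms \<alpha>, Union_model Ms) \<in> leK"
proof -
  have "\<forall>Ms :: 'k \<Rightarrow> _. increasing_sequence Kl leK UNIV Ms \<longrightarrow>
      Union_model Ms \<in> Kl \<and> (\<forall>\<alpha>. (Ms \<alpha>, Union_model Ms) \<in> leK)"
    using nice unfolding nice_order_def Let_def by (elim conjE)
  with assms show "Union_model Ms \<in> Kl" "(Ms \<alpha>, Union_model Ms) \<in> leK" by blast+
qed

lemma image_model_Kl:
  assumes "N \<in> Kl" "inj_on f (universe N)"
  shows "image_model f N \<in> Kl" "isomorphism f N (image_model f N)"
proof -
  show iso: "isomorphism f N (image_model f N)"
    using isomorphism_image_model is_model_Kl assms by blast
  have "image_model f N \<in> K"
    using closed iso is_model_image_model is_model_Kl assms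
    unfolding closed_under_isomorphisms_def members_of_card_def by blast
  moreover have "|universe (image_model f N)| =o |universe N|"
    using iso card_of_ordIso ordIso_symmetric unfolding isomorphism_def by blast
  then have "|universe (image_model f N)| =o |UNIV :: 'k set|"
    using assms(1) ordIso_transitive by (auto simp: members_of_card_def)
  ultimately show "image_model f N \<in> Kl" by (simp add: members_of_card_def)
qed

text \<open>Preservation under isomorphisms turns \<open>N\<close> below \<open>U\<close> into the
  image of \<open>N\<close> below \<open>M\<close>.\<close>

lemma K_embedding_restrict:
  assumes "(N, U) \<in> leK" "isomorphism h U M" "M \<in> Kl"
  shows "K_embedding leK h N M"
proof -
  have "inj_on h (universe N)"
    using assms(2) leK_universe[OF assms(1)] unfolding isomorphism_def bij_betw_def
    by (blast intro: inj_on_subset)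
  then have "isomorphism h N (image_model h N)"
    using image_model_Kl(2) leK_Kl[OF assms(1)] by blast
  then show ?thesis using leK_image[OF assms] unfolding K_embedding_def by blast
qed

lemma K_embedding_comp:
  "isomorphism \<phi> N N' \<Longrightarrow> K_embedding leK f N' N0 \<Longrightarrow> K_embedding leK (f \<circ> \<phi>) N N0"
  unfolding K_embedding_def using isomorphism_comp by blast

section \<open>Pairs of upper bounds that cannot be amalgamated over an initial part of a
  chain\<close>

definition amalgamable ::
  "'u set \<Rightarrow> ('u, 'f, 'p) model \<Rightarrow> ('u, 'f, 'p) model \<Rightarrow> bool" where
  "amalgamable B N1 N2 \<longleftrightarrow>
     (\<exists>N0\<in>Kl. \<exists>f1 f2. K_embedding leK f1 N1 N0 \<and> K_embedding leK f2 N2 N0 \<and>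
        (\<forall>a\<in>B. f1 a = f2 a))"

text \<open>Only the range matters, so repetitions are harmless. One fixed enumeration per model
  lets ordinals name its elements in a way that a colouring can decode.\<close>

definition enumeration :: "('u, 'f, 'p) model \<Rightarrow> 'k \<Rightarrow> 'u" where
  "enumeration N = (SOME e. range e = universe N)"

lemma range_enumeration:
  assumes "N \<in> Kl"
  shows "range (enumeration N) = universe N"
proof -
  have "|UNIV :: 'k set| =o |universe N|"
    using assms ordIso_symmetric by (auto simp: members_of_card_def)
  then have "\<exists>e :: 'k \<Rightarrow> 'u. range e = universe N"
    using card_of_ordIso[of "UNIV :: 'k set" "universe N"] by (auto simp: bij_betw_def)
  then show ?thesis unfolding enumeration_def by (rule someI_ex)
qed

definition initial_part :: "'k \<Rightarrow> ('k \<Rightarrow> ('u, 'f, 'p) model) \<Rightarrow> 'u set" where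
  "initial_part \<delta> Ms = (\<Union>\<alpha><\<delta>. enumeration (Ms \<alpha>) ` {..<\<delta>})"

text \<open>
  The universe type may be exhausted by a model of cardinality \<open>\<lambda>\<close>.  Confining the model of stage
  \<open>\<delta>\<close> to the columns \<open>\<le> \<delta>\<close> of an injected copy of \<open>\<lambda> \<times> \<lambda>\<close> leaves the column \<open>\<delta>\<close> free
  for the new elements of any upper bound of the earlier models.
\<close>
definition roomy_bound ::
  "('k \<times> 'k \<Rightarrow> 'u) \<Rightarrow> 'k \<Rightarrow> ('k \<Rightarrow> ('u, 'f, 'p) model) \<Rightarrow> ('u, 'f, 'p) model \<Rightarrow> bool" where
  "roomy_bound V \<delta> Ms N \<longleftrightarrow>
     N \<in> Kl \<and> universe N \<subseteq> V ` ({..\<delta>} \<times> UNIV) \<and> (\<forall>\<alpha><\<delta>. (Ms \<alpha>, N) \<in> leK)"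

text \<open>The implication keeps the construction going where no pair splits: any two roomy bounds
  then serve. The choice depends only on the models below \<delta>.\<close>

definition split_pair ::
  "('k \<times> 'k \<Rightarrow> 'u) \<Rightarrow> 'k \<Rightarrow> ('k \<Rightarrow> ('u, 'f, 'p) model) \<Rightarrow>
   ('u, 'f, 'p) model \<times> ('u, 'f, 'p) model" where
  "split_pair V \<delta> Ms =
     (SOME p. roomy_bound V \<delta> Ms (fst p) \<and> roomy_bound V \<delta> Ms (snd p) \<and>
        ((\<exists>N1 N2. roomy_bound V \<delta> Ms N1 \<and> roomy_bound V \<delta> Ms N2 \<and>
           \<not> amalgamable (initial_part \<delta> Ms) N1 N2) \<longrightarrow>
         \<not> amalgamable (initial_part \<delta> Ms) (fst p) (snd p)))"

lemma split_pair_cong: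
  assumes "\<And>\<alpha>. \<alpha> < \<delta> \<Longrightarrow> Ms \<alpha> = Ms' \<alpha>"
  shows "split_pair V \<delta> Ms = split_pair V \<delta> Ms'"
proof -
  have "roomy_bound V \<delta> Ms = roomy_bound V \<delta> Ms'"
    using assms by (auto simp: roomy_bound_def fun_eq_iff)
  moreover have "initial_part \<delta> Ms = initial_part \<delta> Ms'"
    using assms by (auto simp: initial_part_def)
  ultimately show ?thesis unfolding split_pair_def by simp
qed

lemma split_pair:
  assumes "roomy_bound V \<delta> Ms N"
  shows "roomy_bound V \<delta> Ms (fst (split_pair V \<delta> Ms))" "roomy_bound V \<delta> Ms (snd (split_pair V \<delta> Ms))"
    and "roomy_bound V \<delta> Ms N1 \<Longrightarrow> roomy_bound V \<delta> Ms N2 \<Longrightarrow>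
      \<not> amalgamable (initial_part \<delta> Ms) N1 N2 \<Longrightarrow>
      \<not> amalgamable (initial_part \<delta> Ms) (fst (split_pair V \<delta> Ms)) (snd (split_pair V \<delta> Ms))"
proof -
  let ?Q = "\<lambda>p. roomy_bound V \<delta> Ms (fst p) \<and> roomy_bound V \<delta> Ms (snd p) \<and>
        ((\<exists>N1 N2. roomy_bound V \<delta> Ms N1 \<and> roomy_bound V \<delta> Ms N2 \<and>
           \<not> amalgamable (initial_part \<delta> Ms) N1 N2) \<longrightarrow>
         \<not> amalgamable (initial_part \<delta> Ms) (fst p) (snd p))"
  have "\<exists>p. ?Q p"
  proof (cases "\<exists>N1 N2. roomy_bound V \<delta> Ms N1 \<and> roomy_bound V \<delta> Ms N2 \<and>
           \<not> amalgamable (initial_part \<delta> Ms) N1 N2")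
    case True
    then obtain N1 N2 where "roomy_bound V \<delta> Ms N1 \<and> roomy_bound V \<delta> Ms N2 \<and>
           \<not> amalgamable (initial_part \<delta> Ms) N1 N2" by blast
    then have "?Q (N1, N2)" by simp
    then show ?thesis ..
  next
    case False
    with assms have "?Q (N, N)" by simp
    then show ?thesis ..
  qed
  then have "?Q (split_pair V \<delta> Ms)" unfolding split_pair_def by (rule someI_ex)
  then show "roomy_bound V \<delta> Ms (fst (split_pair V \<delta> Ms))"
    "roomy_bound V \<delta> Ms (snd (split_pair V \<delta> Ms))"
    "roomy_bound V \<delta> Ms N1 \<Longrightarrow> roomy_bound V \<delta> Ms N2 \<Longrightarrow>
      \<not> amalgamable (initial_part \<delta> Ms) N1 N2 \<Longrightarrow>
      \<not> amalgamable (initial_part \<delta> Ms) (fst (split_pair V \<delta> Ms)) (snd (split_pair V \<delta> Ms))"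
    by blast+
qed

text \<open>Here \<open>N\<close> bounds the \<open>g\<close>-image of the chain. Undo
  \<open>g\<close> on the old elements and send all others into column \<delta>, numbered by an
  injection \<open>k\<close>. Old elements occupy earlier columns only, so the relabelling is
  injective on \<open>universe N\<close>.\<close>

lemma roomy_bound_transport:
  fixes \<delta> :: 'k and Ms :: "'k \<Rightarrow> ('u, 'f, 'p) model"
  defines "X \<equiv> \<Union>\<alpha><\<delta>. universe (Ms \<alpha>)"
  assumes V: "inj V" and N: "N \<in> Kl"
    and room: "\<And>\<alpha>. \<alpha> < \<delta> \<Longrightarrow> universe (Ms \<alpha>) \<subseteq> V ` ({..\<alpha>} \<times> UNIV)"
    and Kl: "\<And>\<alpha>. \<alpha> < \<delta> \<Longrightarrow> Ms \<alpha> \<in> Kl"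
    and le: "\<And>\<alpha>. \<alpha> < \<delta> \<Longrightarrow> (image_model g (Ms \<alpha>), N) \<in> leK"
    and g: "inj_on g X"
  obtains N' \<phi> where "roomy_bound V \<delta> Ms N'" "isomorphism \<phi> N N'" "\<And>x. x \<in> X \<Longrightarrow> \<phi> (g x) = x"
proof -
  have XV: "X \<subseteq> V ` ({..<\<delta>} \<times> UNIV)"
  proof
    fix x assume "x \<in> X"
    then obtain \<alpha> where a: "\<alpha> < \<delta>" "x \<in> universe (Ms \<alpha>)" unfolding X_def by blast
    then have "x \<in> V ` ({..\<alpha>} \<times> UNIV)" using room by blast
    moreover have "{..\<alpha>} \<times> (UNIV :: 'k set) \<subseteq> {..<\<delta>} \<times> UNIV" using a by auto
    ultimately show "x \<in> V ` ({..<\<delta>} \<times> UNIV)" by blast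
  qed
  have "|universe N| \<le>o |UNIV :: 'k set|"
    using N ordIso_imp_ordLeq by (auto simp: members_of_card_def)
  then obtain k :: "'u \<Rightarrow> 'k" where k: "inj_on k (universe N)"
    using card_of_ordLeq[of "universe N" "UNIV :: 'k set"] by blast
  define \<phi> where "\<phi> y = (if y \<in> g ` X then inv_into X g y else V (\<delta>, k y))" for y
  have \<phi>g: "\<phi> (g x) = x" if "x \<in> X" for x
    using that g by (simp add: \<phi>_def)
  have old: "\<phi> y \<in> V ` ({..<\<delta>} \<times> UNIV)" if "y \<in> g ` X" for y
    using that \<phi>g XV by auto
  have new: "\<phi> y = V (\<delta>, k y)" if "y \<notin> g ` X" for y
    using that by (simp add: \<phi>_def)
  have disj: "V (\<delta>, \<beta>) \<notin> V ` ({..<\<delta>} \<times> UNIV)" for \<beta>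
    using V by (auto dest: injD)
  have inj: "inj_on \<phi> (universe N)"
  proof (rule inj_onI)
    fix x y assume a: "x \<in> universe N" "y \<in> universe N" "\<phi> x = \<phi> y"
    show "x = y"
    proof (cases "x \<in> g ` X"; cases "y \<in> g ` X")
      assume "x \<in> g ` X" "y \<in> g ` X"
      then show ?thesis using a(3) \<phi>g by force
    next
      assume "x \<in> g ` X" "y \<notin> g ` X"
      then show ?thesis using a(3) old[of x] new[of y] disj[of "k y"] by metis
    next
      assume "x \<notin> g ` X" "y \<in> g ` X"
      then show ?thesis using a(3) old[of y] new[of x] disj[of "k x"] by metis
    next
      assume "x \<notin> g ` X" "y \<notin> g ` X"
      then have "V (\<delta>, k x) = V (\<delta>, k y)" using a(3) new by simp
      then have "k x = k y" using injD[OF V] by blast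
      then show ?thesis using k a(1,2) by (auto dest: inj_onD)
    qed
  qed
  have "\<phi> y \<in> V ` ({..\<delta>} \<times> UNIV)" for y
  proof (cases "y \<in> g ` X")
    case True
    moreover have "{..<\<delta>} \<times> (UNIV :: 'k set) \<subseteq> {..\<delta>} \<times> UNIV" by auto
    ultimately show ?thesis using old by blast
  qed (simp add: new)
  then have "universe (image_model \<phi> N) \<subseteq> V ` ({..\<delta>} \<times> UNIV)"
    by (auto simp: image_model_def)
  \<comment> \<open>Since \<phi> undoes \<open>g\<close> on \<open>Ms \<alpha>\<close>, carrying the
    relation along \<phi> gives a statement about \<open>Ms \<alpha>\<close> itself.\<close>
  moreover have "(Ms \<alpha>, image_model \<phi> N) \<in> leK" if "\<alpha> < \<delta>" for \<alpha>
  proof -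
    have "image_model \<phi> (image_model g (Ms \<alpha>)) = Ms \<alpha>"
      using that by (intro image_model_inverse[OF is_model_Kl[OF Kl]] \<phi>g) (auto simp: X_def)
    then show ?thesis
      using leK_image[OF le[OF that] image_model_Kl(2,1)[OF N inj]] by simp
  qed
  ultimately have "roomy_bound V \<delta> Ms (image_model \<phi> N)"
    using image_model_Kl(1)[OF N inj] by (simp add: roomy_bound_def)
  then show ?thesis using that image_model_Kl(2)[OF N inj] \<phi>g by blast
qed

section \<open>The chain along a binary sequence\<close>

lemma branch_split_pair:
  "branch (split_pair V) \<eta> \<delta> =
     (if \<eta> \<delta> then snd else fst) (split_pair V \<delta> (branch (split_pair V) \<eta>))"
proof -
  \<comment> \<open>\<open>split_pair\<close> looks only below \<delta>, so the default value in the
    truncated history disappears.\<close>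
  have "split_pair V \<delta> (\<lambda>\<alpha>. if \<alpha> < \<delta> then branch (split_pair V) \<eta> \<alpha> else undefined) =
      split_pair V \<delta> (branch (split_pair V) \<eta>)"
    by (rule split_pair_cong) simp
  then show ?thesis by (simp only: branch.simps[of "split_pair V" \<eta> \<delta>])
qed

text \<open>Niceness bounds every proper initial piece of the chain, and relabelling with
  \<open>g\<close> the identity makes the bound roomy. Hence there is a pair to choose from at each
  \<delta>.\<close>

lemma roomy_bound_branch:
  assumes V: "inj V"
  shows "roomy_bound V \<delta> (branch (split_pair V) \<eta>) (branch (split_pair V) \<eta> \<delta>)"
proof (induction \<delta> rule: less_induct)
  case (less \<delta>)
  let ?Ms = "branch (split_pair V) \<eta>"
  have "increasing_sequence Kl leK {..<\<delta>} ?Ms"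
    unfolding increasing_sequence_def
  proof (intro conjI ballI impI)
    fix \<alpha> \<beta> assume "\<alpha> \<in> {..<\<delta>}" "\<beta> \<in> {..<\<delta>}" "\<alpha> \<le> \<beta>"
    then show "(?Ms \<alpha>, ?Ms \<beta>) \<in> leK"
      using less[of \<beta>] leK_refl[of "?Ms \<beta>"] by (cases "\<alpha> = \<beta>") (simp_all add: roomy_bound_def)
  qed (use less in \<open>simp add: roomy_bound_def\<close>)
  then obtain N where N: "N \<in> Kl" "\<forall>\<alpha><\<delta>. (?Ms \<alpha>, N) \<in> leK"
    using initial_chain_bound by blast
  have "image_model (\<lambda>x. x) L = L" for L :: "('u, 'f, 'p) model"
    by (cases L) (simp add: image_model_def)
  then have le: "(image_model (\<lambda>x. x) (?Ms \<alpha>), N) \<in> leK" if "\<alpha> < \<delta>" for \<alpha>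
    using N(2) that by simp
  have room: "universe (?Ms \<alpha>) \<subseteq> V ` ({..\<alpha>} \<times> UNIV)" and Kl: "?Ms \<alpha> \<in> Kl" if "\<alpha> < \<delta>" for \<alpha>
    using less[OF that] by (simp_all add: roomy_bound_def)
  have "inj_on (\<lambda>x. x) (\<Union>\<alpha><\<delta>. universe (?Ms \<alpha>))" by simp
  from roomy_bound_transport[OF V N(1) room Kl le this]
  obtain N' where "roomy_bound V \<delta> ?Ms N'" by blast
  then have "roomy_bound V \<delta> ?Ms (fst (split_pair V \<delta> ?Ms))"
    "roomy_bound V \<delta> ?Ms (snd (split_pair V \<delta> ?Ms))"
    by (rule split_pair)+
  then show ?case by (cases "\<eta> \<delta>") (simp_all add: branch_split_pair[of V \<eta> \<delta>])
qed

lemma increasing_branch: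
  assumes "inj V"
  shows "increasing_sequence Kl leK UNIV (branch (split_pair V) \<eta>)"
  unfolding increasing_sequence_def
proof (intro conjI ballI impI)
  fix \<alpha> \<beta> :: 'k assume "\<alpha> \<le> \<beta>"
  then show "(branch (split_pair V) \<eta> \<alpha>, branch (split_pair V) \<eta> \<beta>) \<in> leK"
    using roomy_bound_branch[OF assms, of \<beta> \<eta>] leK_refl
    by (cases "\<alpha> = \<beta>") (simp_all add: roomy_bound_def)
qed (use roomy_bound_branch[OF assms] in \<open>simp add: roomy_bound_def\<close>)

text \<open>
  Along \<open>c\<close>, the sequence \<open>s\<close> codes \<open>\<eta>\<close> and the ternary relation ``\<open>h\<close> maps the \<open>\<beta>\<close>-th element
  of the \<open>\<alpha>\<close>-th model to the \<open>\<gamma>\<close>-th element of \<open>M\<close>''.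
\<close>
definition colouring ::
  "('k \<times> 'k \<Rightarrow> 'u) \<Rightarrow> ('k + 'k \<times> 'k \<times> 'k \<Rightarrow> 'k) \<Rightarrow> ('u, 'f, 'p) model \<Rightarrow>
   ('k \<rightharpoonup> bool) \<Rightarrow> bool" where
  "colouring V c M s \<longleftrightarrow>
     (let \<delta> = (LEAST y. y \<notin> dom s);
          Ms = branch (split_pair V) (\<lambda>\<alpha>. s (c (Inl \<alpha>)) = Some True)
      in \<exists>j. K_embedding leK j (fst (split_pair V \<delta> Ms)) M \<and>
           (\<forall>\<alpha><\<delta>. \<forall>\<beta><\<delta>. \<forall>\<gamma><\<delta>. s (c (Inr (\<alpha>, \<beta>, \<gamma>))) = Some True \<longrightarrow>
              j (enumeration (Ms \<alpha>) \<beta>) = enumeration M \<gamma>))"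

text \<open>Extensions of \<open>M\<close> bound the \<open>h\<close>-image of the chain, because
  \<open>M\<close> does. Undoing \<open>h\<close> on the chain turns a failing pair over
  \<open>M\<close> into a failing pair of roomy bounds.\<close>

lemma not_amalgamable_transport:
  assumes V: "inj V" and M: "M \<in> Kl"
    and room: "\<And>\<alpha>. \<alpha> < \<delta> \<Longrightarrow> universe (Ms \<alpha>) \<subseteq> V ` ({..\<alpha>} \<times> UNIV)"
    and U: "\<And>\<alpha>. \<alpha> < \<delta> \<Longrightarrow> (Ms \<alpha>, U) \<in> leK"
    and h: "isomorphism h U M"
    and fail: "\<not> amalgamation_property Kl leK (h ` initial_part \<delta> Ms) M"
  obtains N1 N2 where "roomy_bound V \<delta> Ms N1" "roomy_bound V \<delta> Ms N2"
    "\<not> amalgamable (initial_part \<delta> Ms) N1 N2"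
proof -
  let ?X = "\<Union>\<alpha><\<delta>. universe (Ms \<alpha>)"
  have Kl: "Ms \<alpha> \<in> Kl" if "\<alpha> < \<delta>" for \<alpha> using leK_Kl[OF U[OF that]] by blast
  have "?X \<subseteq> universe U" using leK_universe[OF U] by auto
  then have inj: "inj_on h ?X"
    using h unfolding isomorphism_def bij_betw_def by (blast intro: inj_on_subset)
  have part: "initial_part \<delta> Ms \<subseteq> ?X"
    using range_enumeration[OF Kl] unfolding initial_part_def by fast
  obtain L1 L2 where L: "(M, L1) \<in> leK" "(M, L2) \<in> leK" "\<not> amalgamable (h ` initial_part \<delta> Ms) L1 L2"
    using fail unfolding amalgamation_property_def amalgamable_def by blast
  have le: "(image_model h (Ms \<alpha>), L) \<in> leK" if "\<alpha> < \<delta>" "(M, L) \<in> leK" for \<alpha> L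
    using leK_trans[OF leK_image[OF U[OF that(1)] h M] that(2)] .
  obtain N1 \<phi>1 where 1: "roomy_bound V \<delta> Ms N1" "isomorphism \<phi>1 L1 N1" "\<And>x. x \<in> ?X \<Longrightarrow> \<phi>1 (h x) = x"
    using roomy_bound_transport[OF V _ room Kl le inj] L(1) leK_Kl by blast
  obtain N2 \<phi>2 where 2: "roomy_bound V \<delta> Ms N2" "isomorphism \<phi>2 L2 N2" "\<And>x. x \<in> ?X \<Longrightarrow> \<phi>2 (h x) = x"
    using roomy_bound_transport[OF V _ room Kl le inj] L(2) leK_Kl by blast
  have "\<not> amalgamable (initial_part \<delta> Ms) N1 N2"
  proof
    assume "amalgamable (initial_part \<delta> Ms) N1 N2"
    then obtain N0 f1 f2 where f: "N0 \<in> Kl" "K_embedding leK f1 N1 N0" "K_embedding leK f2 N2 N0"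
      "\<forall>a\<in>initial_part \<delta> Ms. f1 a = f2 a" unfolding amalgamable_def by blast
    \<comment> \<open>Composed with the relabellings, an amalgam of the copies would amalgamate
      \<open>L1\<close> and \<open>L2\<close>, as both relabellings send \<open>h a\<close> to
      \<open>a\<close>.\<close>
    have "(f1 \<circ> \<phi>1) (h a) = (f2 \<circ> \<phi>2) (h a)" if "a \<in> initial_part \<delta> Ms" for a
    proof -
      have "a \<in> ?X" using part that by (rule subsetD)
      then show ?thesis using f(4) 1(3) 2(3) that by simp
    qed
    then have "\<forall>a\<in>h ` initial_part \<delta> Ms. (f1 \<circ> \<phi>1) a = (f2 \<circ> \<phi>2) a" by blast
    then show False
      using L(3) f(1) K_embedding_comp[OF 1(2) f(2)] K_embedding_comp[OF 2(2) f(3)]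
      unfolding amalgamable_def by blast
  qed
  then show ?thesis using that 1(1) 2(1) by blast
qed

lemma room_exists:
  assumes "regular_uncountable_cardinal TYPE('k)" "M \<in> Kl"
  shows "\<exists>V :: 'k \<times> 'k \<Rightarrow> 'u. inj V"
proof -
  obtain p :: "'k \<times> 'k \<Rightarrow> 'k" where p: "inj p" using ex_inj_Times[OF assms(1)] by blast
  have "|UNIV :: 'k set| =o |universe M|"
    using assms(2) ordIso_symmetric by (auto simp: members_of_card_def)
  then obtain e :: "'k \<Rightarrow> 'u" where "inj e"
    using card_of_ordIso[of "UNIV :: 'k set" "universe M"] by (auto simp: bij_betw_def)
  with p show ?thesis using inj_compose by blast
qed

subsection \<open>Refuting the weak diamond\<close>

text \<open>The candidate \<rho> itself steers the branch, and \<open>h\<close> is chosen for the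
  resulting union. Both are coded into one \<open>f\<close>, from which the colouring reconstructs
  the situation below \<delta>.\<close>

lemma no_weak_diamond_for_colouring:
  fixes A :: "'k \<Rightarrow> 'u set"
  assumes reg: "regular_uncountable_cardinal TYPE('k)"
    and cat: "categorical lam K"
    and M: "M \<in> Kl"
    and V: "inj V" and c: "inj c"
    and mono: "\<And>\<alpha> \<beta>. \<alpha> \<le> \<beta> \<Longrightarrow> A \<alpha> \<subseteq> A \<beta>"
    and cont: "\<And>\<delta>. limit_ordinal \<delta> \<Longrightarrow> A \<delta> = (\<Union>\<alpha>\<in>{..<\<delta>}. A \<alpha>)"
    and small: "\<And>\<alpha>. |A \<alpha>| <o |UNIV :: 'k set|"
    and Union: "(\<Union>\<alpha>. A \<alpha>) = universe M"
  shows "\<not> weak_diamond_sequence UNIV (colouring V c M)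
    {\<alpha>. \<not> amalgamation_property Kl leK (A \<alpha>) M} \<rho>"
proof
  let ?S = "{\<alpha>. \<not> amalgamation_property Kl leK (A \<alpha>) M}"
  assume wd: "weak_diamond_sequence UNIV (colouring V c M) ?S \<rho>"
  define N where "N = branch (split_pair V) \<rho>"
  define U where "U = Union_model N"
  have roomy: "roomy_bound V \<delta> N (N \<delta>)" for \<delta>
    unfolding N_def by (rule roomy_bound_branch[OF V])
  have inc: "increasing_sequence Kl leK UNIV N"
    unfolding N_def by (rule increasing_branch[OF V])
  have U: "U \<in> Kl" "\<And>\<alpha>. (N \<alpha>, U) \<in> leK" unfolding U_def using Union_chain[OF inc] by auto
  obtain h where h: "isomorphism h U M" using cat U(1) M unfolding categorical_def by blast
  then have himg: "h ` universe U = universe M" by (simp add: isomorphism_def bij_betw_def)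
  define b where "b \<alpha> \<beta> = h (enumeration (N \<alpha>) \<beta>)" for \<alpha> \<beta>
  have enumN: "range (enumeration (N \<alpha>)) = universe (N \<alpha>)" for \<alpha>
    using roomy range_enumeration by (simp add: roomy_bound_def)
  have "enumeration (N \<alpha>) \<beta> \<in> universe U" for \<alpha> \<beta>
    using enumN[of \<alpha>] leK_universe[OF U(2)[of \<alpha>]] by auto
  then have bM: "b \<alpha> \<beta> \<in> universe M" for \<alpha> \<beta> using himg by (auto simp: b_def)
  have "\<exists>\<gamma>. b \<alpha> \<beta> = enumeration M \<gamma>" for \<alpha> \<beta>
    using bM[of \<alpha> \<beta>] unfolding range_enumeration[OF M, symmetric] by blast
  \<comment> \<open>\<theta> gives an index in the enumeration of \<open>M\<close>; \<xi>, below,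
    gives a stage of \<open>A\<close> containing the element.\<close>
  then obtain \<theta> where \<theta>: "b \<alpha> \<beta> = enumeration M (\<theta> \<alpha> \<beta>)" for \<alpha> \<beta> by metis
  have "\<exists>\<xi>. b \<alpha> \<beta> \<in> A \<xi>" for \<alpha> \<beta>
    using bM[of \<alpha> \<beta>] unfolding Union[symmetric] by blast
  then obtain \<xi> where \<xi>: "b \<alpha> \<beta> \<in> A (\<xi> \<alpha> \<beta>)" for \<alpha> \<beta> by metis
  have "\<exists>\<alpha> \<beta>. a = b \<alpha> \<beta>" if a: "a \<in> universe M" for a
  proof -
    obtain x where x: "x \<in> universe U" "a = h x" using a himg by blast
    then obtain \<alpha> where "x \<in> universe (N \<alpha>)" by (auto simp: U_def Union_model_def)
    then obtain \<beta> where "x = enumeration (N \<alpha>) \<beta>" unfolding enumN[symmetric] by blast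
    with x(2) show ?thesis by (auto simp: b_def)
  qed
  \<comment> \<open>Conversely, \<zeta> and \<chi> locate an element of \<open>M\<close> in the
    chain, by a model and an index in it.\<close>
  then obtain \<zeta> \<chi> where \<zeta>: "a \<in> universe M \<Longrightarrow> a = b (\<zeta> a) (\<chi> a)" for a by metis
  \<comment> \<open>This decodes along \<open>c\<close>; the values outside \<open>range c\<close>
    are immaterial.\<close>
  define f where "f = (\<lambda>x. Some (case inv c x of
      Inl \<alpha> \<Rightarrow> \<rho> \<alpha> | Inr (\<alpha>, \<beta>, \<gamma>) \<Rightarrow> b \<alpha> \<beta> = enumeration M \<gamma>))"
  have f1: "f (c (Inl \<alpha>)) = Some (\<rho> \<alpha>)" for \<alpha> using c by (simp add: f_def)
  have f2: "f (c (Inr (\<alpha>, \<beta>, \<gamma>))) = Some (b \<alpha> \<beta> = enumeration M \<gamma>)" for \<alpha> \<beta> \<gamma>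
    using c by (simp add: f_def)
  \<comment> \<open>\<open>T x\<close> collects the values for all arguments up to \<open>x\<close>,
    so a closure point is closed under these functions of several arguments, and under \<zeta> and
    \<chi> on each earlier \<open>A x\<close>.\<close>
  define T where "T x = case_prod \<theta> ` ({..x} \<times> {..x}) \<union> case_prod \<xi> ` ({..x} \<times> {..x}) \<union>
      (\<lambda>\<alpha>. c (Inl \<alpha>)) ` {..x} \<union> (\<lambda>t. c (Inr t)) ` ({..x} \<times> {..x} \<times> {..x}) \<union> (\<zeta> ` A x \<union> \<chi> ` A x)" for x
  have "|T x| <o |UNIV :: 'k set|" for x
    unfolding T_def
    by (intro small_Un[OF reg] small_image[OF reg] small_Times[OF reg]
        initial_segment_small[OF reg] small)
  then have "club {\<delta>. limit_ordinal \<delta> \<and> (\<forall>\<alpha><\<delta>. T \<alpha> \<subseteq> {..<\<delta>})}"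
    by (rule club_closure_points[OF reg])
  moreover have "f \<in> DOM_lam UNIV" by (auto simp: DOM_lam_def f_def)
  \<comment> \<open>The stationary set of correct guesses meets the club of closure points.\<close>
  ultimately obtain \<delta> where S: "\<not> amalgamation_property Kl leK (A \<delta>) M"
    and guess: "\<rho> \<delta> = colouring V c M (f |` {..<\<delta>})"
    and lim: "limit_ordinal \<delta>" and T: "\<And>x. x < \<delta> \<Longrightarrow> T x \<subseteq> {..<\<delta>}"
    using wd unfolding weak_diamond_sequence_def stationary_def by blast
  have cl2: "\<theta> \<alpha> \<beta> < \<delta>" "\<xi> \<alpha> \<beta> < \<delta>" if "\<alpha> < \<delta>" "\<beta> < \<delta>" for \<alpha> \<beta>
  proof -
    have "\<theta> \<alpha> \<beta> \<in> T (max \<alpha> \<beta>)" "\<xi> \<alpha> \<beta> \<in> T (max \<alpha> \<beta>)" by (force simp: T_def)+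
    then show "\<theta> \<alpha> \<beta> < \<delta>" "\<xi> \<alpha> \<beta> < \<delta>" using T[of "max \<alpha> \<beta>"] that by auto
  qed
  have cl1: "c (Inl \<alpha>) < \<delta>" if "\<alpha> < \<delta>" for \<alpha>
    using T[OF that] by (auto simp: T_def)
  have cl3: "c (Inr (\<alpha>, \<beta>, \<gamma>)) < \<delta>" if "\<alpha> < \<delta>" "\<beta> < \<delta>" "\<gamma> < \<delta>" for \<alpha> \<beta> \<gamma>
  proof -
    let ?x = "max \<alpha> (max \<beta> \<gamma>)"
    have "(\<alpha>, \<beta>, \<gamma>) \<in> {..?x} \<times> {..?x} \<times> {..?x}" by (simp add: le_max_iff_disj)
    then have "c (Inr (\<alpha>, \<beta>, \<gamma>)) \<in> T ?x" unfolding T_def by blast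
    then show ?thesis using T[of ?x] that by auto
  qed
  \<comment> \<open>One inclusion is closure under \<xi>; the other is continuity of
    \<open>A\<close> at the limit \<delta> together with closure under \<zeta> and \<chi>.\<close>
  have part: "h ` initial_part \<delta> N = A \<delta>"
  proof
    show "h ` initial_part \<delta> N \<subseteq> A \<delta>"
    proof
      fix y assume "y \<in> h ` initial_part \<delta> N"
      then obtain \<alpha> \<beta> where ab: "\<alpha> < \<delta>" "\<beta> < \<delta>" "y = b \<alpha> \<beta>" by (auto simp: initial_part_def b_def)
      then have "y \<in> A (\<xi> \<alpha> \<beta>)" using \<xi> by simp
      then show "y \<in> A \<delta>" using mono[OF less_imp_le[OF cl2(2)[OF ab(1,2)]]] by blast
    qed
  next
    show "A \<delta> \<subseteq> h ` initial_part \<delta> N"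
    proof
      fix y assume "y \<in> A \<delta>"
      then obtain x where x: "x < \<delta>" "y \<in> A x" using cont[OF lim] by blast
      then have "\<zeta> y < \<delta>" "\<chi> y < \<delta>" using T[OF x(1)] by (auto simp: T_def)
      moreover have "y = b (\<zeta> y) (\<chi> y)" using \<zeta> x(2) Union by blast
      ultimately show "y \<in> h ` initial_part \<delta> N" unfolding initial_part_def b_def by blast
    qed
  qed
  define P where "P = split_pair V \<delta> N"
  \<comment> \<open>As \<open>f\<close> is total, the least ordinal outside the domain is the length
    of the restriction.\<close>
  have "(LEAST y. y \<notin> dom (f |` {..<\<delta>})) = \<delta>"
    by (rule Least_equality) (auto simp: f_def dom_def not_less[symmetric])
  \<comment> \<open>The codes of \<open>\<rho> \<alpha>\<close> with \<alpha> < \<delta> lie below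
    \<delta>. The decoded sequence may be wrong from \<delta> on, but the models below \<delta> do
    not depend on that.\<close>
  moreover have dec: "branch (split_pair V) (\<lambda>\<alpha>. (f |` {..<\<delta>}) (c (Inl \<alpha>)) = Some True) \<alpha> = N \<alpha>"
    if "\<alpha> < \<delta>" for \<alpha>
    unfolding N_def using that cl1 f1 by (intro branch_cong) (simp add: restrict_map_def)
  moreover have "split_pair V \<delta> (branch (split_pair V) (\<lambda>\<alpha>. (f |` {..<\<delta>}) (c (Inl \<alpha>)) = Some True)) = P"
    unfolding P_def using dec by (rule split_pair_cong)
  ultimately have col: "colouring V c M (f |` {..<\<delta>}) \<longleftrightarrow>
      (\<exists>j. K_embedding leK j (fst P) M \<and>
         (\<forall>\<alpha><\<delta>. \<forall>\<beta><\<delta>. \<forall>\<gamma><\<delta>. b \<alpha> \<beta> = enumeration M \<gamma> \<longrightarrow>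
            j (enumeration (N \<alpha>) \<beta>) = enumeration M \<gamma>))"
    unfolding colouring_def Let_def using cl3 f2 by (simp add: restrict_map_def)
  have "universe (N \<alpha>) \<subseteq> V ` ({..\<alpha>} \<times> UNIV)" for \<alpha>
    using roomy by (simp add: roomy_bound_def)
  \<comment> \<open>\<open>U\<close> bounds the chain below \<delta>, and \<open>h\<close> carries
    the initial part onto \<open>A \<delta>\<close>, so the failure of amalgamation at \<delta> can
    be transported.\<close>
  then obtain N1 N2 where "roomy_bound V \<delta> N N1" "roomy_bound V \<delta> N N2"
    "\<not> amalgamable (initial_part \<delta> N) N1 N2"
    using not_amalgamable_transport[OF V M _ U(2) h S[folded part]] by blast
  then have split: "\<not> amalgamable (initial_part \<delta> N) (fst P) (snd P)"
    unfolding P_def by (rule split_pair(3)[OF roomy])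
  have N\<delta>: "N \<delta> = (if \<rho> \<delta> then snd P else fst P)"
    unfolding P_def N_def by (subst branch_split_pair) simp
  have emb: "K_embedding leK h (N \<delta>) M"
    by (rule K_embedding_restrict[OF U(2) h M])
  show False
  proof (cases "\<rho> \<delta>")
    case True
    then obtain j where j: "K_embedding leK j (fst P) M"
      "\<forall>\<alpha><\<delta>. \<forall>\<beta><\<delta>. \<forall>\<gamma><\<delta>. b \<alpha> \<beta> = enumeration M \<gamma> \<longrightarrow>
         j (enumeration (N \<alpha>) \<beta>) = enumeration M \<gamma>"
      using guess col by blast
    \<comment> \<open>The colouring compares values only with elements of \<open>M\<close> of index
      below \<delta>; closure under \<theta> provides such an index for \<open>h a\<close>.\<close>
    have "j a = h a" if a: "a \<in> initial_part \<delta> N" for a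
    proof -
      obtain \<alpha> \<beta> where ab: "\<alpha> < \<delta>" "\<beta> < \<delta>" "a = enumeration (N \<alpha>) \<beta>"
        using a by (auto simp: initial_part_def)
      then show ?thesis using j(2) \<theta>[of \<alpha> \<beta>] cl2(1) by (metis b_def)
    qed
    \<comment> \<open>Thus \<open>M\<close> amalgamates the pair, via \<open>j\<close> and
      \<open>h\<close>.\<close>
    moreover have "K_embedding leK h (snd P) M" using emb True N\<delta> by simp
    ultimately show False using split j(1) M unfolding amalgamable_def by blast
  next
    case False
    then have "K_embedding leK h (fst P) M" using emb N\<delta> by simp
    \<comment> \<open>Now \<open>h\<close> is a witness for \<open>j\<close>, so the colouring is
      true where \<rho> guessed false.\<close>
    then have "colouring V c M (f |` {..<\<delta>})" unfolding col by (auto simp: b_def)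
    then show False using guess False by simp
  qed
qed

end

theorem theorem4p2:
  fixes \<tau> :: "('f, 'p) vocabulary"
    and K :: "('u, 'f, 'p) model set"
    and leK :: "('u, 'f, 'p) model rel"
    and M :: "('u, 'f, 'p) model"
    and A :: "'k::wellorder \<Rightarrow> 'u set"
  assumes "regular_uncountable_cardinal TYPE('k)"
    and "(UNIV :: 'k set) \<notin> WDmId"
    and "\<forall>N\<in>K. is_model \<tau> N"
    and "closed_under_isomorphisms \<tau> K"
    and "categorical TYPE('k) K"
    and "nice_order TYPE('k) K leK"
    and "M \<in> members_of_card TYPE('k) K"
    and "\<forall>\<alpha> \<beta>. \<alpha> \<le> \<beta> \<longrightarrow> A \<alpha> \<subseteq> A \<beta>"
    and "\<forall>\<delta>. limit_ordinal \<delta> \<longrightarrow> A \<delta> = (\<Union>\<alpha>\<in>{..<\<delta>}. A \<alpha>)"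
    and "\<forall>\<alpha>. |A \<alpha>| <o |UNIV :: 'k set|"
    and "(\<Union>\<alpha>. A \<alpha>) = universe M"
  shows "{\<alpha>. \<not> amalgamation_property (members_of_card TYPE('k) K) leK (A \<alpha>) M} \<in> WDmId"
proof -
  interpret nice_class "TYPE('k)" \<tau> K leK
    using assms(3,4,6) by unfold_locales
  obtain V :: "'k \<times> 'k \<Rightarrow> 'u" where V: "inj V" using room_exists[OF assms(1,7)] by blast
  obtain c :: "'k + 'k \<times> 'k \<times> 'k \<Rightarrow> 'k" where c: "inj c" using ex_inj_code[OF assms(1)] by blast
  \<comment> \<open>A single colouring of binary sequences defeats every \<rho>, which is the first
    alternative in \<open>WDmId\<close>.\<close>
  have "\<nexists>\<rho>. weak_diamond_sequence UNIV (colouring V c M)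
      {\<alpha>. \<not> amalgamation_property Kl leK (A \<alpha>) M} \<rho>"
    using no_weak_diamond_for_colouring[OF assms(1,5,7) V c] assms(8-11) by blast
  then show ?thesis unfolding WDmId_def by blast
qed

end
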